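(* For all $m \in \mathbb{N}$ (with $m\ge 1$) and all $n \ge 3(m+2)$, $$n-1 \le \mathrm{sat}^\ast(n,B_{4,m}) \le 3(m+2)\left\lfloor \frac{n}{3(m+2)} \right\rfloor + \binom{n-3(m+2)\left\lfloor \frac{n}{3(m+2)} \right\rfloor}{2}.$$
   Context: All graphs are finite and simple. An edge-colouring of a graph is proper if any two distinct edges sharing a vertex receive different colours. A rainbow copy of $H$ in an edge-coloured graph $G$ is a subgraph of $G$ isomorphic to $H$ all of whose edges have distinct colours. A graph $G$ is properly rainbow $H$-saturated if (1) there is a proper edge-colouring of $G$ containing no rainbow copy of $H$, and (2) for every non-edge $e \notin E(G)$ (a pair of distinct non-adjacent vertices of $G$), every proper edge-colouring of $G+e$ contains a rainbow copy of $H$. The proper rainbow saturation number $\mathrm{sat}^\ast(n,H)$ is the minimum number of edges in a properly rainbow $H$-saturated graph on $n$ vertices. $P_k$ denotes the path on $k$ vertices. For $k,m\ge 1$, the broom $B_{k,m}$ is the tree obtained by appending $m$ pendant vertices to an endpoint of the path $P_k$ (i.e. adding $m$ new vertices, each adjacent only to that endpoint); e.g. $B_{4,1}=P_5$. *)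

theory Defs
  imports Main
begin

record 'a ugraph =
  verts :: "'a set"
  edges :: "'a set set"

definition simple_graph :: "'a ugraph \<Rightarrow> bool" where
  "simple_graph G \<longleftrightarrow> finite (verts G) \<and> (\<forall>e\<in>edges G. e \<subseteq> verts G \<and> card e = 2)"

definition subgraph :: "'a ugraph \<Rightarrow> 'a ugraph \<Rightarrow> bool" where
  "subgraph F G \<longleftrightarrow> simple_graph F \<and> verts F \<subseteq> verts G \<and> edges F \<subseteq> edges G"

definition isomorphic :: "'a ugraph \<Rightarrow> 'b ugraph \<Rightarrow> bool" where
  "isomorphic G H \<longleftrightarrow> (\<exists>f. bij_betw f (verts G) (verts H) \<and>
     (\<forall>u\<in>verts G. \<forall>v\<in>verts G. {u, v} \<in> edges G \<longleftrightarrow> {f u, f v} \<in> edges H))"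

definition add_edge :: "'a ugraph \<Rightarrow> 'a set \<Rightarrow> 'a ugraph" where
  "add_edge G e = G\<lparr>edges := insert e (edges G)\<rparr>"

definition non_edge :: "'a ugraph \<Rightarrow> 'a set \<Rightarrow> bool" where
  "non_edge G e \<longleftrightarrow> e \<subseteq> verts G \<and> card e = 2 \<and> e \<notin> edges G"

(* Colours are natural numbers, which loses nothing as the graphs are finite;
   the values of a colouring outside the edge set are irrelevant. *)
definition proper_colouring :: "'a ugraph \<Rightarrow> ('a set \<Rightarrow> nat) \<Rightarrow> bool" where
  "proper_colouring G c \<longleftrightarrow>
     (\<forall>e\<in>edges G. \<forall>f\<in>edges G. e \<noteq> f \<and> e \<inter> f \<noteq> {} \<longrightarrow> c e \<noteq> c f)"

definition rainbow_copy :: "'b ugraph \<Rightarrow> 'a ugraph \<Rightarrow> ('a set \<Rightarrow> nat) \<Rightarrow> 'a ugraph \<Rightarrow> bool" where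
  "rainbow_copy H G c F \<longleftrightarrow> subgraph F G \<and> isomorphic F H \<and> inj_on c (edges F)"

definition properly_rainbow_saturated :: "'b ugraph \<Rightarrow> 'a ugraph \<Rightarrow> bool" where
  "properly_rainbow_saturated H G \<longleftrightarrow> simple_graph G \<and>
     (\<exists>c. proper_colouring G c \<and> \<not> (\<exists>F. rainbow_copy H G c F)) \<and>
     (\<forall>e. non_edge G e \<longrightarrow>
        (\<forall>c. proper_colouring (add_edge G e) c \<longrightarrow> (\<exists>F. rainbow_copy H (add_edge G e) c F)))"

(* The minimum ranges over graphs with vertices in nat, which up to isomorphism are all
   finite graphs. It is attained as soon as H has an edge: see sat_star_attained. *)
definition sat_star :: "nat \<Rightarrow> 'b ugraph \<Rightarrow> nat" where
  "sat_star n H = Inf {card (edges G) | G :: nat ugraph.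
     card (verts G) = n \<and> properly_rainbow_saturated H G}"

definition path_graph :: "nat \<Rightarrow> nat ugraph" where
  "path_graph k = \<lparr>verts = {..<k}, edges = {{i, i + 1} | i. i + 1 < k}\<rparr>"

(* Meaningful for k \<ge> 1: the pendant vertices k, ..., k + m - 1 are attached to
   the endpoint k - 1 of the path on 0, ..., k - 1. *)
definition broom :: "nat \<Rightarrow> nat \<Rightarrow> nat ugraph" where
  "broom k m = \<lparr>verts = verts (path_graph k) \<union> {k..<k + m},
     edges = edges (path_graph k) \<union> {{k - 1, j} | j. j \<in> {k..<k + m}}\<rparr>"

lemma simple_graph_broom:
  assumes "k \<ge> 1"
  shows "simple_graph (broom k m)"
  using assms by (auto simp: simple_graph_def broom_def path_graph_def card_insert_if)

lemma broom_4_1: "broom 4 1 = path_graph 5"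
proof -
  have "{{i, i + 1} | i. i + 1 < (5::nat)} = {{i, i + 1} | i. i + 1 < 4} \<union> {{3, 4}}"
    by (auto simp: less_Suc_eq numeral_eq_Suc)
  moreover have "{{4 - 1, j} | j. j \<in> {4..<4 + 1}} = {{3, 4::nat}}"
    by (auto simp: numeral_eq_Suc)
  ultimately show ?thesis
    by (auto simp: broom_def path_graph_def)
qed

lemma sat_star_attained:
  fixes H :: "'b ugraph"
  assumes H: "simple_graph H" and ne: "edges H \<noteq> {}"
  shows "\<exists>G :: nat ugraph. card (verts G) = n \<and> properly_rainbow_saturated H G \<and>
           card (edges G) = sat_star n H"
proof -
  define g :: "nat set set \<Rightarrow> nat ugraph" where "g E = \<lparr>verts = {..<n}, edges = E\<rparr>" for E
  define S where "S = {E. simple_graph (g E) \<and>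
    (\<exists>c. proper_colouring (g E) c \<and> \<not> (\<exists>F. rainbow_copy H (g E) c F))}"
  have "S \<subseteq> Pow (Pow {..<n})"
    by (auto simp: S_def simple_graph_def g_def)
  then have fin: "finite S"
    by (rule finite_subset) simp
  have "{} \<in> S"
  proof -
    have "\<not> rainbow_copy H (g {}) c F" for c F
    proof
      assume "rainbow_copy H (g {}) c F"
      then have F: "edges F = {}" and "isomorphic F H"
        by (auto simp: rainbow_copy_def subgraph_def g_def)
      then obtain f where f: "bij_betw f (verts F) (verts H)"
        "\<forall>u\<in>verts F. \<forall>v\<in>verts F. {u, v} \<in> edges F \<longleftrightarrow> {f u, f v} \<in> edges H"
        by (auto simp: isomorphic_def)
      obtain e where e: "e \<in> edges H" using ne by blast
      then have "card e = 2" "e \<subseteq> verts H" using H by (auto simp: simple_graph_def)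
      then obtain x y where xy: "e = {x, y}" "x \<in> verts H" "y \<in> verts H"
        by (auto simp: card_2_iff)
      then obtain u v where "u \<in> verts F" "v \<in> verts F" "x = f u" "y = f v"
        using f(1) unfolding bij_betw_def by blast
      then show False using f(2) F e xy by auto
    qed
    then show ?thesis
      by (auto simp: S_def simple_graph_def g_def proper_colouring_def)
  qed
  then obtain E where E: "E \<in> S" and max: "\<And>E'. E' \<in> S \<Longrightarrow> E \<subseteq> E' \<Longrightarrow> E = E'"
    using finite_has_maximal[OF fin] by blast
  have "properly_rainbow_saturated H (g E)"
    unfolding properly_rainbow_saturated_def
  proof (intro conjI allI impI)
    show "simple_graph (g E)" "\<exists>c. proper_colouring (g E) c \<and> \<not> (\<exists>F. rainbow_copy H (g E) c F)"
      using E by (auto simp: S_def)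
  next
    fix e c
    assume e: "non_edge (g E) e" and c: "proper_colouring (add_edge (g E) e) c"
    have eq: "add_edge (g E) e = g (insert e E)"
      by (simp add: add_edge_def g_def)
    have "insert e E \<notin> S"
      using max[of "insert e E"] e by (auto simp: non_edge_def g_def)
    moreover have "simple_graph (g (insert e E))"
      using E e by (auto simp: S_def simple_graph_def non_edge_def g_def)
    ultimately show "\<exists>F. rainbow_copy H (add_edge (g E) e) c F"
      using c unfolding eq S_def by blast
  qed
  moreover have "card (verts (g E)) = n" by (simp add: g_def)
  ultimately have "{card (edges G) | G :: nat ugraph.
      card (verts G) = n \<and> properly_rainbow_saturated H G} \<noteq> {}" by blast
  from Inf_nat_def1[OF this] show ?thesis
    unfolding sat_star_def by force
qed

end

theory Submission
  imports Defs
begin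

text \<open>
  Upper bound: take disjoint copies of a triangle with \<open>m + 1\<close> leaves at each of its vertices.
  Colouring the leaf edges at a corner with one common set of \<open>m\<close> colours and the colour of the
  opposite triangle edge leaves no rainbow broom, whereas every further edge meeting such a copy
  yields, in every proper colouring, a rainbow path on four vertices whose last vertex has
  \<open>m + 2\<close> other neighbours; at most two of these are lost to colour clashes. So a maximal
  rainbow-free extension adds edges only among the vertices outside the copies.

  Lower bound: with fewer than \<open>n - 1\<close> edges there are two tree components. In each of them some
  vertex is isolated or is a leaf whose neighbour has at most one non-leaf neighbour; call these
  vertices \<open>x\<close> and \<open>y\<close>. After renaming colours on one side, the paths leaving \<open>x\<close> and \<open>y\<close>
  both start with colours \<open>a, b\<close>, and giving \<open>xy\<close> the colour \<open>b\<close> creates no rainbow path on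
  five vertices through \<open>xy\<close>, hence no rainbow broom.
\<close>

section \<open>Brooms described by their vertices\<close>

definition broom_edges :: "'a \<Rightarrow> 'a \<Rightarrow> 'a \<Rightarrow> 'a \<Rightarrow> 'a set \<Rightarrow> 'a set set" where
  "broom_edges p0 p1 p2 p3 Q = {{p0, p1}, {p1, p2}, {p2, p3}} \<union> (\<lambda>q. {p3, q}) ` Q"

text \<open>The path is \<open>p0 p1 p2 p3\<close>, and \<open>p3\<close> is the endpoint that
  carries the pendant vertices \<open>Q\<close>.\<close>

definition rainbow_broom ::
    "'a ugraph \<Rightarrow> ('a set \<Rightarrow> nat) \<Rightarrow> nat \<Rightarrow> 'a \<Rightarrow> 'a \<Rightarrow> 'a \<Rightarrow> 'a \<Rightarrow> 'a set \<Rightarrow> bool" where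
  "rainbow_broom G c m p0 p1 p2 p3 Q \<longleftrightarrow>
     distinct [p0, p1, p2, p3] \<and> finite Q \<and> card Q = m \<and> {p0, p1, p2, p3} \<inter> Q = {} \<and>
     broom_edges p0 p1 p2 p3 Q \<subseteq> edges G \<and> inj_on c (broom_edges p0 p1 p2 p3 Q)"

lemma verts_broom_4: "verts (broom 4 m) = {0, 1, 2, 3} \<union> {4..<4 + m}"
  by (auto simp: broom_def path_graph_def)

lemma edges_broom_4: "edges (broom 4 m) = broom_edges 0 1 2 3 {4..<4 + m}"
proof -
  have "{{i, i + 1} | i. i + 1 < (4::nat)} = {{0, 1}, {1, 2}, {2, 3}}"
    by (auto simp: less_Suc_eq numeral_eq_Suc)
  moreover have "{{4 - 1, j} | j. j \<in> {4..<4 + m}} = (\<lambda>q. {3, q}) ` {4..<4 + m}"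
    by auto
  ultimately show ?thesis
    unfolding broom_def path_graph_def broom_edges_def ugraph.select_convs by (simp only:)
qed

text \<open>\<open>isomorphic\<close> compares all pairs of vertices. Since the edges of a simple
  graph are sets of vertices and an injective map is injective on such sets, it suffices to
  transport the edge set.\<close>

lemma isomorphic_image:
  assumes H: "simple_graph H" and g: "bij_betw g (verts H) (verts F)"
    and E: "edges F = (`) g ` edges H"
  shows "isomorphic F H"
proof -
  let ?f = "inv_into (verts H) g"
  have "{u, v} \<in> edges F \<longleftrightarrow> {?f u, ?f v} \<in> edges H" if uv: "u \<in> verts F" "v \<in> verts F" for u v
  proof -
    have inj: "inj_on g (verts H)" using g by (auto simp: bij_betw_def)
    obtain u' v' where *: "u' \<in> verts H" "v' \<in> verts H" "u = g u'" "v = g v'"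
      using uv g unfolding bij_betw_def by (metis imageE)
    have "{u, v} = g ` {u', v'}" using * by auto
    then have "{u, v} \<in> edges F \<longleftrightarrow> (\<exists>e\<in>edges H. g ` {u', v'} = g ` e)"
      using E by auto
    also have "\<dots> \<longleftrightarrow> {u', v'} \<in> edges H"
      using inj_on_image_eq_iff[OF inj, of "{u', v'}"] * H
      by (fastforce simp: simple_graph_def)
    finally show ?thesis using * inj by simp
  qed
  then show ?thesis
    unfolding isomorphic_def using bij_betw_inv_into[OF g] by blast
qed

lemma rainbow_copy_broom_iff:
  assumes G: "simple_graph G"
  shows "(\<exists>F. rainbow_copy (broom 4 m) G c F) \<longleftrightarrow> (\<exists>p0 p1 p2 p3 Q. rainbow_broom G c m p0 p1 p2 p3 Q)"
proof
  assume "\<exists>F. rainbow_copy (broom 4 m) G c F"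
  then obtain F f where F: "subgraph F G" "inj_on c (edges F)"
    and f: "bij_betw f (verts F) (verts (broom 4 m))"
    and fE: "\<forall>u\<in>verts F. \<forall>v\<in>verts F. {u, v} \<in> edges F \<longleftrightarrow> {f u, f v} \<in> edges (broom 4 m)"
    by (auto simp: rainbow_copy_def isomorphic_def)
  define g where "g = inv_into (verts F) f"
  have g: "bij_betw g (verts (broom 4 m)) (verts F)"
    unfolding g_def using f by (rule bij_betw_inv_into)
  have gE: "{g i, g j} \<in> edges F"
    if "i \<in> verts (broom 4 m)" "j \<in> verts (broom 4 m)" "{i, j} \<in> edges (broom 4 m)" for i j
  proof -
    have "f (g i) = i" "f (g j) = j"
      using that f by (simp_all add: g_def bij_betw_inv_into_right)
    moreover have "g i \<in> verts F" "g j \<in> verts F"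
      using that g by (auto dest: bij_betw_apply)
    ultimately show ?thesis using fE that(3) by simp
  qed
  let ?V = "{0, 1, 2, 3} \<union> {4..<4 + m}"
  have inj: "inj_on g ?V" using g by (simp add: bij_betw_def verts_broom_4)
  have sub: "broom_edges (g 0) (g 1) (g 2) (g 3) (g ` {4..<4 + m}) \<subseteq> edges F"
    unfolding broom_edges_def
    using gE[of 0 1] gE[of 1 2] gE[of 2 3] gE[of 3]
    by (simp add: edges_broom_4 verts_broom_4 broom_edges_def image_subset_iff)
  have "rainbow_broom G c m (g 0) (g 1) (g 2) (g 3) (g ` {4..<4 + m})"
    unfolding rainbow_broom_def
  proof (intro conjI)
    show "distinct [g 0, g 1, g 2, g 3]" using inj by (auto simp: inj_on_eq_iff)
    show "card (g ` {4..<4 + m}) = m"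
      using card_image[OF inj_on_subset[OF inj, of "{4..<4+m}"]] by auto
    show "{g 0, g 1, g 2, g 3} \<inter> g ` {4..<4 + m} = {}"
      using inj by (auto simp: inj_on_eq_iff)
    show "broom_edges (g 0) (g 1) (g 2) (g 3) (g ` {4..<4 + m}) \<subseteq> edges G"
      using sub F by (auto simp: subgraph_def)
    show "inj_on c (broom_edges (g 0) (g 1) (g 2) (g 3) (g ` {4..<4 + m}))"
      using F(2) sub by (rule inj_on_subset)
  qed simp
  then show "\<exists>p0 p1 p2 p3 Q. rainbow_broom G c m p0 p1 p2 p3 Q" by blast
next
  assume "\<exists>p0 p1 p2 p3 Q. rainbow_broom G c m p0 p1 p2 p3 Q"
  then obtain p0 p1 p2 p3 Q where R: "rainbow_broom G c m p0 p1 p2 p3 Q" by blast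
  then have d: "distinct [p0, p1, p2, p3]" "{p0, p1, p2, p3} \<inter> Q = {}"
    and Q: "finite Q" "card Q = m" by (auto simp: rainbow_broom_def)
  obtain h where h: "bij_betw h {4..<4 + m} Q"
    using finite_same_card_bij[of "{4..<4 + m}" Q] Q by auto
  define g where "g i = (if i = 0 then p0 else if i = 1 then p1 else if i = 2 then p2
    else if i = 3 then p3 else h i)" for i :: nat
  define F where "F = \<lparr>verts = {p0, p1, p2, p3} \<union> Q, edges = broom_edges p0 p1 p2 p3 Q\<rparr>"
  have gh: "g ` {4..<4 + m} = Q"
    using h by (auto simp: g_def bij_betw_def image_def)
  have "bij_betw g ({0, 1, 2, 3} \<union> {4..<4 + m}) ({p0, p1, p2, p3} \<union> Q)"
  proof (rule bij_betw_combine)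
    show "bij_betw g {0, 1, 2, 3} {p0, p1, p2, p3}"
      using d by (auto simp: bij_betw_def inj_on_def g_def)
    show "bij_betw g {4..<4 + m} Q"
      using h by (subst bij_betw_cong[of _ _ h]) (auto simp: g_def)
  qed (use d in auto)
  moreover have "(`) g ` broom_edges 0 1 2 3 {4..<4 + m} = broom_edges p0 p1 p2 p3 Q"
  proof -
    have "(`) g ` (\<lambda>q. {3, q}) ` {4..<4 + m} = (\<lambda>q. {p3, q}) ` g ` {4..<4 + m}"
      by (simp add: image_image g_def insert_commute)
    moreover have "g 0 = p0" "g 1 = p1" "g 2 = p2" "g 3 = p3" by (simp_all add: g_def)
    ultimately show ?thesis
      unfolding broom_edges_def image_Un gh by (simp only: image_insert image_empty)
  qed
  ultimately have "isomorphic F (broom 4 m)"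
    by (intro isomorphic_image[of _ g] simple_graph_broom)
      (auto simp: F_def verts_broom_4 edges_broom_4)
  moreover have "subgraph F G"
  proof -
    have sub: "edges F \<subseteq> edges G" using R by (simp add: rainbow_broom_def F_def)
    \<comment> \<open>A broom has no isolated vertices, so both its vertices and the size of its
      edges are inherited from the simple graph \<open>G\<close>.\<close>
    have "verts F = \<Union> (edges F) \<union> Q" using R
      by (auto simp: F_def broom_edges_def)
    moreover have "Q \<subseteq> \<Union> (edges F)" by (auto simp: F_def broom_edges_def)
    ultimately have "verts F = \<Union> (edges F)" by blast
    moreover have "finite (verts F)" using Q by (simp add: F_def)
    ultimately show ?thesis
      using sub G unfolding subgraph_def simple_graph_def by blast
  qed
  ultimately have "rainbow_copy (broom 4 m) G c F"
    using R by (simp add: rainbow_copy_def rainbow_broom_def F_def)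
  then show "\<exists>F. rainbow_copy (broom 4 m) G c F" by blast
qed

lemma simple_graph_add_edge:
  "simple_graph G \<Longrightarrow> non_edge G e \<Longrightarrow> simple_graph (add_edge G e)"
  by (auto simp: simple_graph_def non_edge_def add_edge_def)

lemma edge_neq: "simple_graph G \<Longrightarrow> {u, v} \<in> edges G \<Longrightarrow> u \<noteq> v"
  by (force simp: simple_graph_def)

lemma proper_colouringD:
  assumes "proper_colouring G c" "{u, v} \<in> edges G" "{u, w} \<in> edges G" "v \<noteq> w"
  shows "c {u, v} \<noteq> c {u, w}"
  using assms by (auto simp: proper_colouring_def doubleton_eq_iff)

text \<open>The edges from \<open>p3\<close> to \<open>N\<close> have distinct colours, so each of
  the colours of \<open>p0 p1\<close> and \<open>p1 p2\<close> rules out at most one of them. The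
  colour of \<open>p2 p3\<close> rules out none, by properness. Hence \<open>m\<close> of the
  \<open>m + 2\<close> candidates survive.\<close>

lemma rainbow_broom_extend:
  assumes c: "proper_colouring G c" "simple_graph G"
    and d: "distinct [p0, p1, p2, p3]"
    and E: "{p0, p1} \<in> edges G" "{p1, p2} \<in> edges G" "{p2, p3} \<in> edges G"
    and ne: "c {p0, p1} \<noteq> c {p2, p3}"
    and N: "finite N" "{p0, p1, p2, p3} \<inter> N = {}" "\<And>q. q \<in> N \<Longrightarrow> {p3, q} \<in> edges G"
    and m: "m + 2 \<le> card N"
  shows "\<exists>Q. rainbow_broom G c m p0 p1 p2 p3 Q"
proof -
  have inj: "inj_on (\<lambda>q. c {p3, q}) N"
    using proper_colouringD[OF c(1)] N(3) by (meson inj_onI)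
  define B where "B = {q \<in> N. c {p3, q} \<in> {c {p0, p1}, c {p1, p2}}}"
  have B: "finite B" "B \<subseteq> N" using N(1) by (auto simp: B_def)
  have "card B = card ((\<lambda>q. c {p3, q}) ` B)"
    using card_image inj_on_subset[OF inj B(2)] by metis
  also have "\<dots> \<le> card {c {p0, p1}, c {p1, p2}}"
    by (rule card_mono) (auto simp: B_def)
  also have "\<dots> \<le> 2" by (simp add: card_insert_if)
  finally have "m \<le> card (N - B)"
    using m card_Diff_subset[OF B] by linarith
  then obtain Q where Q: "Q \<subseteq> N - B" "card Q = m" "finite Q"
    using obtain_subset_with_card_n by metis
  have s: "{p2, p1} = {p1, p2}" "{p3, p2} = {p2, p3}" "{p1, p0} = {p0, p1}" by auto
  have 1: "c {p0, p1} \<noteq> c {p1, p2}" "c {p1, p2} \<noteq> c {p2, p3}"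
    using proper_colouringD[OF c(1), of p1 p0 p2] proper_colouringD[OF c(1), of p2 p1 p3] E d s
    by auto
  have 2: "c {p3, q} \<noteq> c {p2, p3}" if "q \<in> Q" for q
    using proper_colouringD[OF c(1), of p3 q p2] E N(2,3) Q(1) s that by auto
  have 3: "c {p3, q} \<noteq> c {p0, p1} \<and> c {p3, q} \<noteq> c {p1, p2}" if "q \<in> Q" for q
    using that Q(1) by (auto simp: B_def)
  have 4: "q = r" if "q \<in> Q" "r \<in> Q" "c {p3, q} = c {p3, r}" for q r
    using inj_onD[OF inj] that Q(1) by auto
  have "inj_on c (broom_edges p0 p1 p2 p3 Q)"
    unfolding inj_on_def broom_edges_def using ne 1 2 3 4 by (auto; metis)
  moreover have "broom_edges p0 p1 p2 p3 Q \<subseteq> edges G"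
    using E N(3) Q(1) by (auto simp: broom_edges_def)
  moreover have "{p0, p1, p2, p3} \<inter> Q = {}" using N(2) Q(1) by blast
  ultimately show ?thesis
    using d Q by (auto simp: rainbow_broom_def)
qed

section \<open>Rainbow brooms forced by an extra edge at a triangle with leaves\<close>

text \<open>The listed edges need only be present: \<open>G\<close> may have further edges at these
  vertices, because the graphs of interest are extensions of the construction.\<close>

definition triangle_with_leaves ::
    "'a ugraph \<Rightarrow> nat \<Rightarrow> 'a \<Rightarrow> 'a \<Rightarrow> 'a \<Rightarrow> 'a set \<Rightarrow> 'a set \<Rightarrow> 'a set \<Rightarrow> bool" where
  "triangle_with_leaves G l a b c A B C \<longleftrightarrow>
     distinct [a, b, c] \<and> {a, b, c} \<inter> (A \<union> B \<union> C) = {} \<and>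
     A \<inter> B = {} \<and> B \<inter> C = {} \<and> A \<inter> C = {} \<and>
     finite A \<and> finite B \<and> finite C \<and> card A = l \<and> card B = l \<and> card C = l \<and>
     {a, b} \<in> edges G \<and> {b, c} \<in> edges G \<and> {a, c} \<in> edges G \<and>
     (\<forall>x\<in>A. {a, x} \<in> edges G) \<and> (\<forall>x\<in>B. {b, x} \<in> edges G) \<and> (\<forall>x\<in>C. {c, x} \<in> edges G)"

lemma triangle_with_leaves_swap:
  "triangle_with_leaves G l a b c A B C \<Longrightarrow> triangle_with_leaves G l a c b A C B"
  unfolding triangle_with_leaves_def by (auto simp: insert_commute)

text \<open>Together with \<open>x\<close>, the corner \<open>a\<close> has \<open>m + 2\<close>
  candidates for pendant vertices. The path \<open>z c b a\<close> starts at a leaf \<open>z\<close>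
  of \<open>c\<close> with \<open>c z\<close> and \<open>a b\<close> of different colours; it exists
  because \<open>c\<close> has at least two leaves.\<close>

lemma rainbow_broom_hub_edge:
  assumes G: "proper_colouring G col" "simple_graph G"
    and T: "triangle_with_leaves G (m + 1) a b c A B C"
    and m: "m \<ge> 1"
    and x: "{a, x} \<in> edges G" "x \<notin> insert b (insert c A)"
  shows "\<exists>p0 p1 p2 p3 Q. rainbow_broom G col m p0 p1 p2 p3 Q"
proof -
  have *: ?thesis if T: "triangle_with_leaves G (m + 1) a b c A B C"
    and x: "{a, x} \<in> edges G" "x \<notin> insert b (insert c A)" "x \<notin> C" for b c B C
  proof -
    note T = T[unfolded triangle_with_leaves_def]
    have "a \<noteq> x" using edge_neq[OF G(2) x(1)] .
    have "\<exists>z\<in>C. col {c, z} \<noteq> col {a, b}"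
    proof (rule ccontr)
      assume "\<not> ?thesis"
      then have "col {c, y} = col {c, z}" if "y \<in> C" "z \<in> C" for y z
        using that by simp
      then have "y = z" if "y \<in> C" "z \<in> C" for y z
        using proper_colouringD[OF G(1), of c y z] T that by metis
      then have "card C \<le> Suc 0" using T card_le_Suc0_iff_eq[of C] by blast
      then show False using T m by simp
    qed
    then obtain z where z: "z \<in> C" "col {c, z} \<noteq> col {a, b}" by blast
    have "\<exists>Q. rainbow_broom G col m z c b a Q"
    proof (rule rainbow_broom_extend[OF G, of _ _ _ _ "insert x A"])
      show "m + 2 \<le> card (insert x A)" using T x by simp
      show "{z, c, b, a} \<inter> insert x A = {}"
        using T x z \<open>a \<noteq> x\<close> by auto
    qed (use T x z in \<open>auto simp: insert_commute\<close>)
    then show ?thesis by blast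
  qed
  show ?thesis
  \<comment> \<open>The path must avoid \<open>x\<close>; if \<open>x\<close> is a leaf of
    \<open>c\<close>, the roles of \<open>b\<close> and \<open>c\<close> are exchanged.\<close>
  proof (cases "x \<in> C")
    case True
    then have "x \<notin> B" using T by (auto simp: triangle_with_leaves_def)
    then show ?thesis using *[OF triangle_with_leaves_swap[OF T]] x by auto
  next
    case False
    then show ?thesis using *[OF T] x by auto
  qed
qed

text \<open>On the path \<open>x a1 a c\<close> the candidates at \<open>c\<close> are its leaves
  and \<open>b\<close>. The only obstruction is equal colours on \<open>a1 x\<close> and
  \<open>a c\<close>; then the mirrored path \<open>x a1 a b\<close> works, since \<open>a b\<close>
  and \<open>a c\<close> have different colours.\<close>

lemma rainbow_broom_leaf_edge:
  assumes G: "proper_colouring G col" "simple_graph G"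
    and T: "triangle_with_leaves G (m + 1) a b c A B C"
    and a1: "a1 \<in> A"
    and x: "{a1, x} \<in> edges G" "x \<notin> {a, b, c}"
  shows "\<exists>p0 p1 p2 p3 Q. rainbow_broom G col m p0 p1 p2 p3 Q"
proof -
  have *: ?thesis if T: "triangle_with_leaves G (m + 1) a b c A B C" and a1: "a1 \<in> A"
    and x: "{a1, x} \<in> edges G" "x \<notin> {a, b, c}" "x \<notin> C" and col: "col {a1, x} \<noteq> col {a, c}"
    for a b c A B C a1 x
  proof -
    note T = T[unfolded triangle_with_leaves_def]
    have "a1 \<noteq> x" using edge_neq[OF G(2) x(1)] .
    have "\<exists>Q. rainbow_broom G col m x a1 a c Q"
    proof (rule rainbow_broom_extend[OF G, of _ _ _ _ "insert b C"])
      show "m + 2 \<le> card (insert b C)" using T x by simp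
      show "distinct [x, a1, a, c]" using T x a1 \<open>a1 \<noteq> x\<close> by auto
      show "{x, a1, a, c} \<inter> insert b C = {}"
        using T x a1 by auto
    qed (use T x a1 col in \<open>auto simp: insert_commute\<close>)
    then show ?thesis by blast
  qed
  have ne: "col {a, b} \<noteq> col {a, c}"
    using T proper_colouringD[OF G(1), of a b c] by (simp add: triangle_with_leaves_def)
  \<comment> \<open>If \<open>x\<close> is a leaf of \<open>b\<close>, the mirrored path would use
    up a candidate. Instead the edge is read from its other end, on the path
    \<open>a1 x b c\<close>; now \<open>a c\<close> and \<open>b c\<close> have different
    colours.\<close>
  have opposite: ?thesis if T: "triangle_with_leaves G (m + 1) a b c A B C"
    and a1: "a1 \<in> A" and x: "{a1, x} \<in> edges G" "x \<in> B" for a b c A B C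
  proof -
    have rot: "triangle_with_leaves G (m + 1) b a c B A C"
      using T unfolding triangle_with_leaves_def by (auto simp: insert_commute)
    have "col {a, c} \<noteq> col {b, c}"
      using T proper_colouringD[OF G(1), of c a b]
      by (auto simp: triangle_with_leaves_def insert_commute)
    moreover have "x \<notin> {a, b, c}" "x \<notin> C" "a1 \<notin> {a, b, c}" "a1 \<notin> C"
      using T x a1 by (auto simp: triangle_with_leaves_def)
    moreover have "{x, a1} \<in> edges G" "col {x, a1} = col {a1, x}"
      using x(1) by (simp_all add: insert_commute)
    ultimately show ?thesis
      using *[OF T a1 x(1)] *[OF rot x(2), of a1] by (metis insert_commute)
  qed
  consider "x \<in> B" | "x \<in> C" | "x \<notin> B" "x \<notin> C" by blast
  then show ?thesis
  proof cases
    case 1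
    then show ?thesis using opposite[OF T a1 x(1)] by blast
  next
    case 2
    then show ?thesis using opposite[OF triangle_with_leaves_swap[OF T] a1 x(1)] by blast
  next
    case 3
    then show ?thesis
      using *[OF T a1 x(1,2)] *[OF triangle_with_leaves_swap[OF T] a1 x(1)] x(2) ne
      by (metis insert_commute)
  qed
qed

section \<open>The disjoint copies as a graph on numbers\<close>

text \<open>
  The vertex \<open>3 * ((m + 2) * b + i) + t\<close> is the triangle vertex with number \<open>t\<close> of the copy \<open>b\<close>
  if \<open>i = 0\<close>, and a leaf at that triangle vertex if \<open>0 < i < m + 2\<close>.
\<close>

definition block :: "nat \<Rightarrow> nat \<Rightarrow> nat" where "block m v = v div 3 div (m + 2)"
definition idx :: "nat \<Rightarrow> nat \<Rightarrow> nat" where "idx m v = v div 3 mod (m + 2)"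

definition corner :: "nat \<Rightarrow> nat" where "corner v = v mod 3"

lemma vertex_eqI:
  assumes "block m u = block m v" "idx m u = idx m v" "corner u = corner v"
  shows "u = v"
  using assms unfolding block_def idx_def corner_def by (metis div_mod_decomp)

lemma corner_less [simp]: "corner v < 3"
  by (simp add: corner_def)

text \<open>Only the residue of \<open>t\<close> modulo 3 matters. So \<open>t + 1\<close> and
  \<open>t + 2\<close> name the other two corners cyclically, and any vertex number may itself serve
  as \<open>t\<close>.\<close>

definition vertex :: "nat \<Rightarrow> nat \<Rightarrow> nat \<Rightarrow> nat \<Rightarrow> nat" where
  "vertex m b i t = 3 * ((m + 2) * b + i) + corner t"

lemma vertex_div_3: "vertex m b i t div 3 = (m + 2) * b + i"
proof -
  have "(3 * x + r) div 3 = x" if "r < 3" for x r :: nat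
    using that by simp
  then show ?thesis unfolding vertex_def using corner_less by blast
qed

lemma vertex_simps [simp]:
  "corner (vertex m b i t) = corner t"
  "i < m + 2 \<Longrightarrow> idx m (vertex m b i t) = i"
  "i < m + 2 \<Longrightarrow> block m (vertex m b i t) = b"
proof -
  have "(3 * x + r mod 3) mod 3 = r mod 3" for x r :: nat
    by simp
  then show "corner (vertex m b i t) = corner t"
    unfolding vertex_def corner_def by blast
  have "((m + 2) * x + r) mod (m + 2) = r" "((m + 2) * x + r) div (m + 2) = x"
    if "r < m + 2" for x r :: nat
    using that by (simp_all only: mod_mult_self4 div_mult_self4 mod_less div_less)
  moreover assume "i < m + 2"
  ultimately show "idx m (vertex m b i t) = i" "block m (vertex m b i t) = b"
    unfolding idx_def block_def vertex_div_3 by blast+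
qed

lemma idx_less [simp]: "idx m v < m + 2"
  by (simp add: idx_def)

lemma vertex_decode [simp]: "vertex m (block m v) (idx m v) v = v"
  by (rule vertex_eqI[of m]) (simp_all only: vertex_simps idx_less)

lemma less_iff_block: "v < 3 * (m + 2) * k \<longleftrightarrow> block m v < k"
proof -
  have "block m v = v div (3 * (m + 2))" unfolding block_def div_mult2_eq ..
  moreover have "v div q < k \<longleftrightarrow> v < q * k" if "q > 0" for q
    using div_less_iff_less_mult[OF that] by (simp add: mult.commute)
  ultimately show ?thesis by simp
qed

text \<open>The first branch of the conditional gives the leaf edges, the second the triangle
  edges.\<close>

definition adj :: "nat \<Rightarrow> nat \<Rightarrow> nat \<Rightarrow> bool" where
  "adj m u v \<longleftrightarrow> block m u = block m v \<and>
     (if corner u = corner v then (idx m u = 0) \<noteq> (idx m v = 0) else idx m u = 0 \<and> idx m v = 0)"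

definition base_edges :: "nat \<Rightarrow> nat \<Rightarrow> nat set set" where
  "base_edges m k = {{u, v} | u v. block m u < k \<and> adj m u v}"

lemma adj_sym: "adj m u v \<longleftrightarrow> adj m v u"
  by (auto simp: adj_def)

lemma adj_neq: "adj m u v \<Longrightarrow> u \<noteq> v"
  by (auto simp: adj_def)

lemma adj_block: "adj m u v \<Longrightarrow> block m u = block m v"
  by (simp add: adj_def)

lemma base_edges_iff: "{u, v} \<in> base_edges m k \<longleftrightarrow> block m u < k \<and> adj m u v"
  using adj_sym[of m u v] adj_block[of m u v] by (auto simp: base_edges_def doubleton_eq_iff)

lemma base_edgesE:
  assumes "e \<in> base_edges m k" "u \<in> e"
  obtains v where "e = {u, v}" "block m u < k" "adj m u v"
proof -
  obtain x y where e: "e = {x, y}" and x: "block m x < k" and xy: "adj m x y"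
    using assms(1) by (auto simp: base_edges_def)
  have y: "block m y < k" "adj m y x"
    using x adj_block[OF xy] xy adj_sym by auto
  have "u = x \<or> u = y" using assms(2) e by simp
  then show ?thesis
    using that[of x] that[of y] e x xy y by (metis insert_commute)
qed

definition base_graph :: "nat \<Rightarrow> nat \<Rightarrow> nat \<Rightarrow> nat ugraph" where
  "base_graph m k n = \<lparr>verts = {..<n}, edges = base_edges m k\<rparr>"

lemma simple_base_graph:
  assumes "3 * (m + 2) * k \<le> n"
  shows "simple_graph (base_graph m k n)"
proof -
  have "v < n" if "block m v < k" for v
    using that assms less_iff_block[of v m k] by linarith
  then have "e \<subseteq> {..<n} \<and> card e = 2" if "e \<in> base_edges m k" for e
    using that by (auto simp: base_edges_def dest: adj_neq adj_block)
  then show ?thesis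
    by (simp add: simple_graph_def base_graph_def)
qed

text \<open>Each vertex is charged with one edge: a leaf with the edge to its corner, a corner with
  the edge to the cyclically next corner. Every edge is charged, so there are at most as many edges
  as vertices.\<close>

lemma card_base_edges: "card (base_edges m k) \<le> 3 * (m + 2) * k"
proof -
  define next_edge where "next_edge v =
    {v, if idx m v = 0 then vertex m (block m v) 0 (v + 1) else vertex m (block m v) 0 v}" for v
  have "{u, v} \<in> next_edge ` {..<3 * (m + 2) * k}" if uv: "block m u < k" "adj m u v" for u v
  proof -
    have bv: "block m v < k" using uv by (simp add: adj_def)
    have "{u, v} = next_edge u \<or> {u, v} = next_edge v"
    proof (cases "corner u = corner v")
      case True
      then consider "idx m u \<noteq> 0" "idx m v = 0" | "idx m v \<noteq> 0" "idx m u = 0"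
        using uv(2) by (auto simp: adj_def)
      then show ?thesis
      proof cases
        case 1
        then have "vertex m (block m u) 0 u = v"
          using vertex_decode[of m v] True adj_block[OF uv(2)] by (simp add: vertex_def)
        then show ?thesis using 1 by (simp add: next_edge_def)
      next
        case 2
        then have "vertex m (block m v) 0 v = u"
          using vertex_decode[of m u] True adj_block[OF uv(2)] by (simp add: vertex_def)
        then show ?thesis using 2 by (simp add: next_edge_def insert_commute)
      qed
    next
      case False
      then have hub: "idx m u = 0" "idx m v = 0" "block m u = block m v"
        using uv(2) by (auto simp: adj_def)
      \<comment> \<open>Of two different residues modulo 3, one is the successor of the
        other.\<close>
      have "corner (u + 1) = corner v \<or> corner (v + 1) = corner u"
        using False corner_less[of u] corner_less[of v]
        unfolding corner_def Suc_eq_plus1[symmetric] mod_Suc by (simp split: if_splits) linarith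
      then show ?thesis
      proof
        assume "corner (u + 1) = corner v"
        then have "vertex m (block m u) 0 (u + 1) = v"
          using vertex_decode[of m v] hub by (simp add: vertex_def)
        then show ?thesis using hub by (simp add: next_edge_def)
      next
        assume "corner (v + 1) = corner u"
        then have "vertex m (block m v) 0 (v + 1) = u"
          using vertex_decode[of m u] hub by (simp add: vertex_def)
        then show ?thesis using hub by (simp add: next_edge_def insert_commute)
      qed
    qed
    then show ?thesis using uv(1) bv unfolding less_iff_block[symmetric] by blast
  qed
  then have "base_edges m k \<subseteq> next_edge ` {..<3 * (m + 2) * k}"
    by (auto simp: base_edges_def)
  then show ?thesis
    using surj_card_le[of "{..<3 * (m + 2) * k}"] by simp
qed

section \<open>A proper colouring of the copies without rainbow broom\<close>

text \<open>
  The edge between corners \<open>s\<close> and \<open>t\<close> gets the number \<open>3 - (s + t)\<close> of the third corner; leaf 1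
  at a corner gets the number of that corner, and leaf \<open>i \<ge> 2\<close> gets the colour \<open>i + 1 \<ge> 3\<close>.
  The sums only serve to make this a function of the unordered pair.
\<close>

definition base_colour :: "nat \<Rightarrow> nat set \<Rightarrow> nat" where
  "base_colour m e = (let i = \<Sum>v\<in>e. idx m v; t = \<Sum>v\<in>e. corner v in
     if i = 0 then 3 - t else if i = 1 then t div 2 else i + 1)"

lemma adj_hub_cases:
  assumes "adj m u v" "idx m u = 0"
  obtains (hub) "idx m v = 0" "corner u \<noteq> corner v" | (leaf) "idx m v \<noteq> 0" "corner v = corner u"
  using assms unfolding adj_def by metis

lemma adj_leaf:
  assumes "adj m u v" "idx m u \<noteq> 0"
  shows "idx m v = 0" "corner v = corner u"
  using assms unfolding adj_def by metis+

text \<open>Evaluates the sums with \<open>u\<close> as a corner end. Both ends of a leaf edge have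
  the same corner number, so their sum is its double and \<open>t div 2\<close> recovers it.\<close>

lemma base_colour_edge:
  assumes "adj m u v" "idx m u = 0"
  shows "base_colour m {u, v} =
    (if idx m v = 0 then 3 - (corner u + corner v) else if idx m v = 1 then corner u else idx m v + 1)"
  using assms
proof (cases rule: adj_hub_cases)
  case hub
  then show ?thesis
    using adj_neq[OF assms(1)] assms(2) by (simp add: base_colour_def)
next
  case leaf
  then show ?thesis
    using adj_neq[OF assms(1)] assms(2) by (simp add: base_colour_def)
qed

lemma hub_of_two_neighbours:
  assumes "adj m u v" "adj m u w" "v \<noteq> w"
  shows "idx m u = 0"
proof (rule ccontr)
  assume u: "idx m u \<noteq> 0"
  have "v = w"
    using adj_leaf[OF assms(1) u] adj_leaf[OF assms(2) u] adj_block[OF assms(1)]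
      adj_block[OF assms(2)] vertex_eqI by metis
  then show False using assms(3) by simp
qed

text \<open>Around corner \<open>r\<close> the triangle edges use the two numbers below 3 other than
  \<open>r\<close>, leaf 1 uses \<open>r\<close>, and the other leaves use distinct colours from 3
  on.\<close>

lemma proper_base_colour: "proper_colouring (base_graph m k n) (base_colour m)"
proof -
  have *: "base_colour m {u, v} \<noteq> base_colour m {u, w}"
    if uv: "adj m u v" "adj m u w" "v \<noteq> w" for u v w
  proof -
    have u: "idx m u = 0" using hub_of_two_neighbours[OF uv] .
    have diff: "\<not> (idx m v = idx m w \<and> corner v = corner w)"
      using vertex_eqI[of m v w] uv(3) adj_block[OF uv(1)] adj_block[OF uv(2)] by metis
    have 1: "3 - (r + s) \<noteq> 3 - (r + t)"
      if "r < 3" "s < 3" "t < 3" "r \<noteq> s" "r \<noteq> t" "s \<noteq> t" for r s t :: nat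
      using that by (auto simp: less_Suc_eq numeral_3_eq_3)
    have 2: "3 - (r + s) \<noteq> r" if "r < 3" "s < 3" "r \<noteq> s" for r s :: nat
      using that by (auto simp: less_Suc_eq numeral_3_eq_3)
    have 3: "3 - (r + s) \<noteq> i + 1" if "i \<noteq> 0" "i \<noteq> 1" "r \<noteq> s" for r s i :: nat
      using that by linarith
    have cls: "corner u = corner x \<longleftrightarrow> idx m x \<noteq> 0" if "adj m u x" for x
      using adj_hub_cases[OF that u] by metis
    have 5: "corner u \<noteq> i + 1" if "i \<noteq> 0" "i \<noteq> 1" for i
      using that corner_less[of u] by linarith
    show ?thesis
    proof (cases "idx m v = 0"; cases "idx m w = 0")
      assume "idx m v = 0" "idx m w = 0"
      then show ?thesis
        using diff 1[of "corner u" "corner v" "corner w"] cls uv(1,2)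
        by (simp add: base_colour_edge[OF uv(1) u] base_colour_edge[OF uv(2) u])
    next
      assume "idx m v = 0" "idx m w \<noteq> 0"
      then show ?thesis
        using 2[of "corner u" "corner v"] 3[of "idx m w" "corner u" "corner v"] cls uv(1,2)
        by (simp add: base_colour_edge[OF uv(1) u] base_colour_edge[OF uv(2) u])
    next
      assume "idx m v \<noteq> 0" "idx m w = 0"
      then show ?thesis
        using 2[of "corner u" "corner w"] 3[of "idx m v" "corner u" "corner w", symmetric] cls uv(1,2)
        by (simp add: base_colour_edge[OF uv(1) u] base_colour_edge[OF uv(2) u])
    next
      assume "idx m v \<noteq> 0" "idx m w \<noteq> 0"
      moreover from this have "idx m v \<noteq> idx m w"
        using diff cls[OF uv(1)] cls[OF uv(2)] by metis
      ultimately show ?thesis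
        using 5[of "idx m v", symmetric] 5[of "idx m w"]
        by (simp add: base_colour_edge[OF uv(1) u] base_colour_edge[OF uv(2) u])
    qed
  qed
  have "base_colour m e \<noteq> base_colour m f"
    if ef: "e \<in> base_edges m k" "f \<in> base_edges m k" "e \<noteq> f" "e \<inter> f \<noteq> {}" for e f
  proof -
    obtain u where u: "u \<in> e" "u \<in> f" using ef by blast
    obtain v w where "e = {u, v}" "f = {u, w}" "adj m u v" "adj m u w"
      using base_edgesE[OF ef(1) u(1)] base_edgesE[OF ef(2) u(2)] by metis
    then show ?thesis using * ef(3) by auto
  qed
  then show ?thesis by (auto simp: proper_colouring_def base_graph_def)
qed

text \<open>The vertices \<open>p1\<close>, \<open>p2\<close>, \<open>p3\<close> have two neighbours
  each, so they are the three corners, and \<open>p0\<close> and \<open>Q\<close> are leaves at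
  \<open>p1\<close> and \<open>p3\<close>. Leaf 1 at \<open>p1\<close> repeats the colour of
  \<open>p2 p3\<close>, and leaf 1 at \<open>p3\<close> that of \<open>p1 p2\<close>. So
  \<open>Q\<close> consists of all other leaves at \<open>p3\<close>, one of which has the index of
  \<open>p0\<close> and hence repeats the colour of \<open>p0 p1\<close>.\<close>

lemma base_graph_no_rainbow_broom:
  assumes m: "m \<ge> 1"
  shows "\<not> rainbow_broom (base_graph m k n) (base_colour m) m p0 p1 p2 p3 Q"
proof
  assume R: "rainbow_broom (base_graph m k n) (base_colour m) m p0 p1 p2 p3 Q"
  then have d: "distinct [p0, p1, p2, p3]" "{p0, p1, p2, p3} \<inter> Q = {}"
    and Q: "finite Q" "card Q = m"
    and sub: "broom_edges p0 p1 p2 p3 Q \<subseteq> base_edges m k"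
    and inj: "inj_on (base_colour m) (broom_edges p0 p1 p2 p3 Q)"
    by (auto simp: rainbow_broom_def base_graph_def)
  have E: "adj m p0 p1" "adj m p1 p2" "adj m p2 p3" "\<And>q. q \<in> Q \<Longrightarrow> adj m p3 q"
    using sub by (auto simp: broom_edges_def base_edges_iff image_subset_iff)
  then have E': "adj m p1 p0" "adj m p2 p1" "adj m p3 p2"
    by (metis adj_sym)+
  obtain q0 where q0: "q0 \<in> Q" using Q m by fastforce
  have hub: "idx m p1 = 0" "idx m p2 = 0" "idx m p3 = 0"
    using hub_of_two_neighbours[OF E'(1) E(2)] hub_of_two_neighbours[OF E'(2) E(3)]
      hub_of_two_neighbours[OF E'(3) E(4)[OF q0]] d q0 by auto
  have b: "block m p1 = block m p2" "block m p2 = block m p3" "block m p0 = block m p1"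
    using E(1-3)[THEN adj_block] by simp_all
  have cls: "corner p1 \<noteq> corner p2" "corner p2 \<noteq> corner p3" "corner p1 \<noteq> corner p3"
    using vertex_eqI[of m p1 p2] vertex_eqI[of m p2 p3] vertex_eqI[of m p1 p3] hub b d by auto
  have lt: "corner p1 < 3" "corner p2 < 3" "corner p3 < 3" by simp_all
  have third: "v \<in> {p1, p2, p3}" if v: "idx m v = 0" "block m v = block m p3" for v
  proof -
    have "corner v = corner p1 \<or> corner v = corner p2 \<or> corner v = corner p3"
      using cls lt corner_less[of v] by linarith
    then show ?thesis
      using vertex_eqI[of m v p1] vertex_eqI[of m v p2] vertex_eqI[of m v p3] v hub b by auto
  qed
  have leaf: "idx m q \<noteq> 0 \<and> corner q = corner p3 \<and> block m q = block m p3" if "q \<in> Q" for q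
  proof -
    have "block m q = block m p3" using adj_block[OF E(4)[OF that]] by simp
    moreover have "idx m q \<noteq> 0" using third[of q] calculation that d(2) by auto
    ultimately show ?thesis using adj_hub_cases[OF E(4)[OF that] hub(3)] by metis
  qed
  have leaf0: "idx m p0 \<noteq> 0"
    using third[of p0] d b by auto
  have complement: "3 - (r + s) = t"
    if "r < 3" "s < 3" "t < 3" "r \<noteq> s" "s \<noteq> t" "t \<noteq> r" for r s t :: nat
    using that by (auto simp: less_Suc_eq numeral_3_eq_3)
  have c23: "base_colour m {p2, p3} = corner p1"
    using base_colour_edge[OF E(3) hub(2)] hub cls complement[OF lt(2,3,1)] by simp
  have c12: "base_colour m {p1, p2} = corner p3"
    using base_colour_edge[OF E(2) hub(1)] hub cls complement[OF lt] by simp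
  have c01: "base_colour m {p0, p1} = (if idx m p0 = 1 then corner p1 else idx m p0 + 1)"
    using base_colour_edge[OF E'(1) hub(1)] leaf0 by (simp add: insert_commute)
  have cq: "base_colour m {p3, q} = (if idx m q = 1 then corner p3 else idx m q + 1)" if "q \<in> Q" for q
    using base_colour_edge[OF E(4)[OF that] hub(3)] leaf[OF that] by simp
  have e: "{p0, p1} \<in> broom_edges p0 p1 p2 p3 Q" "{p1, p2} \<in> broom_edges p0 p1 p2 p3 Q"
    "{p2, p3} \<in> broom_edges p0 p1 p2 p3 Q" "\<And>q. q \<in> Q \<Longrightarrow> {p3, q} \<in> broom_edges p0 p1 p2 p3 Q"
    by (auto simp: broom_edges_def)
  have p0: "idx m p0 \<noteq> 1"
    using inj_onD[OF inj _ e(1) e(3)] c01 c23 d by (auto simp: doubleton_eq_iff)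
  have Q1: "idx m q \<noteq> 1" if "q \<in> Q" for q
    using inj_onD[OF inj _ e(2) e(4)[OF that]] c12 cq[OF that] d by (auto simp: doubleton_eq_iff)
  \<comment> \<open>The \<open>m\<close> different indices lie among only \<open>m\<close> values,
    so they exhaust them.\<close>
  have "idx m ` Q = {2..<m + 2}"
  proof (rule card_subset_eq)
    show "idx m ` Q \<subseteq> {2..<m + 2}"
    proof
      fix i assume "i \<in> idx m ` Q"
      then obtain q where "q \<in> Q" "i = idx m q" by blast
      then show "i \<in> {2..<m + 2}"
        using leaf[of q] Q1[of q] idx_less[of m q] by auto
    qed
    have "inj_on (idx m) Q" using leaf vertex_eqI by (intro inj_onI) metis
    then show "card (idx m ` Q) = card {2..<m + 2}" using Q by (simp add: card_image)
  qed simp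
  moreover have "idx m p0 < m + 2" by (rule idx_less)
  ultimately have "idx m p0 \<in> idx m ` Q" using leaf0 p0 by simp
  then obtain q where q: "q \<in> Q" "idx m q = idx m p0" by (metis imageE)
  then have "base_colour m {p0, p1} = base_colour m {p3, q}"
    using c01 cq[OF q(1)] p0 by simp
  then show False
    using inj_onD[OF inj _ e(1) e(4)[OF q(1)]] d q(1) by (auto simp: doubleton_eq_iff)
qed

section \<open>Extensions of the copies and the upper bound\<close>

lemma corner_shift: "corner t \<noteq> corner (t + 1)" "corner t \<noteq> corner (t + 2)"
    "corner (t + 1) \<noteq> corner (t + 2)"
proof -
  have *: "corner t \<noteq> corner (t + 1)" for t
    unfolding corner_def Suc_eq_plus1[symmetric] mod_Suc by simp
  show "corner t \<noteq> corner (t + 1)" "corner (t + 1) \<noteq> corner (t + 2)"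
    using *[of t] *[of "t + 1"] by simp_all
  show "corner t \<noteq> corner (t + 2)"
    unfolding corner_def add_2_eq_Suc' mod_Suc by simp
qed

lemma vertex_eq_iff:
  assumes "i < m + 2" "j < m + 2"
  shows "vertex m b i s = vertex m b j t \<longleftrightarrow> i = j \<and> corner s = corner t"
proof
  assume "vertex m b i s = vertex m b j t"
  then show "i = j \<and> corner s = corner t" using vertex_simps assms by metis
qed (simp add: vertex_def)

lemma base_edges_vertex_iff:
  assumes "i < m + 2" "j < m + 2"
  shows "{vertex m b i s, vertex m b j t} \<in> base_edges m k \<longleftrightarrow> b < k \<and>
    (if corner s = corner t then (i = 0) \<noteq> (j = 0) else i = 0 \<and> j = 0)"
  unfolding base_edges_iff adj_def
  by (simp only: vertex_simps(1) vertex_simps(2,3)[OF assms(1)] vertex_simps(2,3)[OF assms(2)] simp_thms)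

definition leaves :: "nat \<Rightarrow> nat \<Rightarrow> nat \<Rightarrow> nat set" where
  "leaves m b t = (\<lambda>i. vertex m b i t) ` {1..<m + 2}"

lemma base_triangle:
  assumes G: "base_edges m k \<subseteq> edges G" and b: "b < k"
  shows "triangle_with_leaves G (m + 1) (vertex m b 0 t) (vertex m b 0 (t + 1)) (vertex m b 0 (t + 2))
    (leaves m b t) (leaves m b (t + 1)) (leaves m b (t + 2))"
proof -
  note ne = corner_shift[of t, simplified]
  have card: "finite (leaves m b s)" "card (leaves m b s) = m + 1" for s
    unfolding leaves_def by (auto simp: card_image inj_on_def vertex_eq_iff)
  have disj: "leaves m b r \<inter> leaves m b s = {}" if "corner r \<noteq> corner s" for r s
    using that by (auto simp: leaves_def vertex_eq_iff)
  have hub: "vertex m b 0 r \<notin> leaves m b s" for r s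
    by (auto simp: leaves_def vertex_eq_iff)
  have tri: "{vertex m b 0 r, vertex m b 0 s} \<in> edges G" if "corner r \<noteq> corner s" for r s
    using that b G base_edges_vertex_iff[of 0 m 0 b r s k] by auto
  have leaf: "{vertex m b 0 s, x} \<in> edges G" if "x \<in> leaves m b s" for s x
    using that b G base_edges_vertex_iff[of 0 m _ b s s k] by (auto simp: leaves_def)
  have "vertex m b 0 r \<noteq> vertex m b 0 s" if "corner r \<noteq> corner s" for r s
    using that by (simp add: vertex_eq_iff)
  then show ?thesis
    unfolding triangle_with_leaves_def
    by (intro conjI ballI) (simp_all add: ne card disj hub tri leaf)
qed

text \<open>If \<open>e\<close> has an end at a corner, of \<open>u\<close>'s own copy when that end
  is not \<open>u\<close>, then the extra edge is one at a corner. Otherwise \<open>u\<close> is a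
  leaf and the other end avoids the three corners of its copy.\<close>

lemma rainbow_broom_extra_edge:
  assumes m: "m \<ge> 1" and G: "proper_colouring G c" "simple_graph G" "base_edges m k \<subseteq> edges G"
    and e: "e \<in> edges G" "e \<notin> base_edges m k" and u: "u \<in> e" "block m u < k"
  shows "\<exists>p0 p1 p2 p3 Q. rainbow_broom G c m p0 p1 p2 p3 Q"
proof -
  have hub: ?thesis if h: "idx m h = 0" "block m h < k" and y: "{h, y} \<in> edges G" "{h, y} \<notin> base_edges m k"
    for h y
  proof -
    have eq: "vertex m (block m h) 0 h = h" using vertex_decode[of m h] h(1) by simp
    note T = base_triangle[OF G(3) h(2), of h, unfolded eq]
    \<comment> \<open>Read in the base edges alone, the copy shows that \<open>h\<close> is joined
      by base edges to the other two corners and to its own leaves; so \<open>y\<close> is none of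
      these.\<close>
    have T0: "triangle_with_leaves \<lparr>verts = {}, edges = base_edges m k\<rparr> (m + 1) h
        (vertex m (block m h) 0 (h + 1)) (vertex m (block m h) 0 (h + 2)) (leaves m (block m h) h)
        (leaves m (block m h) (h + 1)) (leaves m (block m h) (h + 2))"
      using base_triangle[where m = m and k = k and b = "block m h" and t = h
          and G = "\<lparr>verts = {}, edges = base_edges m k\<rparr>"] h(2)
      unfolding eq by simp
    have "y \<notin> insert (vertex m (block m h) 0 (h + 1)) (insert (vertex m (block m h) 0 (h + 2))
        (leaves m (block m h) h))"
      using T0 y(2) unfolding triangle_with_leaves_def by auto
    then show ?thesis using rainbow_broom_hub_edge[OF G(1,2) T m y(1)] by blast
  qed
  obtain x where x: "e = {u, x}"
  proof -
    have "card e = 2" using G(2) e(1) by (auto simp: simple_graph_def)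
    then obtain y z where "e = {y, z}" by (auto simp: card_2_iff)
    then show thesis using that[of y] that[of z] u(1) by (auto simp: insert_commute)
  qed
  show ?thesis
  proof (cases "idx m u = 0")
    case True
    then show ?thesis using hub[of u x] u e x by simp
  next
    case False
    show ?thesis
    proof (cases "idx m x = 0 \<and> block m x = block m u")
      case True
      then show ?thesis using hub[of x u] u e x by (simp add: insert_commute)
    next
      case x': False
      note T = base_triangle[OF G(3) u(2), of u]
      have "vertex m (block m u) (idx m u) u \<in> leaves m (block m u) u"
        unfolding leaves_def using False idx_less[of m u] by (intro imageI) auto
      then have ul: "u \<in> leaves m (block m u) u" by simp
      have "x \<noteq> vertex m (block m u) 0 s" for s
        using x' vertex_simps(2,3)[of 0 m "block m u" s] by auto
      then show ?thesis
        using rainbow_broom_leaf_edge[OF G(1,2) T ul] e x by blast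
    qed
  qed
qed

text \<open>Among the finitely many edge sets that admit some proper colouring without rainbow copy,
  a maximal one above \<open>edges G0\<close> is saturated. Its colouring need not extend
  \<open>c\<close>.\<close>

lemma saturated_extension:
  assumes G0: "simple_graph G0" "proper_colouring G0 c" "\<nexists>F. rainbow_copy H G0 c F"
  obtains G where "verts G = verts G0" "edges G0 \<subseteq> edges G" "properly_rainbow_saturated H G"
proof -
  define g where "g E = G0\<lparr>edges := E\<rparr>" for E
  define S where "S = {E. simple_graph (g E) \<and>
    (\<exists>c. proper_colouring (g E) c \<and> \<not> (\<exists>F. rainbow_copy H (g E) c F))}"
  have "S \<subseteq> Pow (Pow (verts G0))"
    by (auto simp: S_def simple_graph_def g_def)
  then have fin: "finite S"
    using G0(1) by (auto intro: finite_subset simp: simple_graph_def)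
  have "edges G0 \<in> S" using G0 by (auto simp: S_def g_def)
  then obtain E where E: "E \<in> S" "edges G0 \<subseteq> E" and max: "\<And>E'. E' \<in> S \<Longrightarrow> E \<subseteq> E' \<Longrightarrow> E = E'"
    using finite_has_maximal2[OF fin] by metis
  have "\<exists>F. rainbow_copy H (add_edge (g E) e) c F"
    if e: "non_edge (g E) e" and c: "proper_colouring (add_edge (g E) e) c" for e c
  proof -
    have eq: "add_edge (g E) e = g (insert e E)"
      by (simp add: add_edge_def g_def)
    have "insert e E \<notin> S"
      using max[of "insert e E"] e by (auto simp: non_edge_def g_def)
    moreover have "simple_graph (g (insert e E))"
      using E simple_graph_add_edge[OF _ e] eq by (auto simp: S_def)
    ultimately show ?thesis
      using c unfolding eq S_def by blast
  qed
  then have "properly_rainbow_saturated H (g E)"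
    using E(1) by (auto simp: properly_rainbow_saturated_def S_def)
  then show ?thesis using that[of "g E"] E(2) by (simp add: g_def)
qed

lemma sat_star_broom_le:
  assumes m: "m \<ge> 1" and k: "3 * (m + 2) * k \<le> n"
  shows "sat_star n (broom 4 m) \<le> 3 * (m + 2) * k + ((n - 3 * (m + 2) * k) choose 2)"
proof -
  let ?M = "3 * (m + 2) * k"
  note simple = simple_base_graph[OF k]
  have "\<nexists>F. rainbow_copy (broom 4 m) (base_graph m k n) (base_colour m) F"
    unfolding rainbow_copy_broom_iff[OF simple] using base_graph_no_rainbow_broom[OF m] by blast
  then obtain G where G: "verts G = {..<n}" "base_edges m k \<subseteq> edges G"
      and sat: "properly_rainbow_saturated (broom 4 m) G"
    using saturated_extension[OF simple proper_base_colour, of "broom 4 m"]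
    by (metis base_graph_def ugraph.select_convs)
  obtain c where c: "proper_colouring G c" "\<nexists>F. rainbow_copy (broom 4 m) G c F"
    and GS: "simple_graph G"
    using sat by (auto simp: properly_rainbow_saturated_def)
  \<comment> \<open>The copies occupy exactly the vertices below \<open>?M\<close>, and an added
    edge meeting them would force a rainbow broom.\<close>
  have "edges G - base_edges m k \<subseteq> {e. e \<subseteq> {?M..<n} \<and> card e = 2}"
  proof
    fix e assume e: "e \<in> edges G - base_edges m k"
    then have "e \<subseteq> {..<n}" "card e = 2" using GS G(1) by (auto simp: simple_graph_def)
    moreover have "\<not> u < ?M" if "u \<in> e" for u
      using rainbow_broom_extra_edge[OF m c(1) GS G(2) _ _ that] e c(2)
      unfolding rainbow_copy_broom_iff[OF GS] less_iff_block by blast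
    ultimately show "e \<in> {e. e \<subseteq> {?M..<n} \<and> card e = 2}" by force
  qed
  then have "card (edges G - base_edges m k) \<le> card {e. e \<subseteq> {?M..<n} \<and> card e = 2}"
    by (rule card_mono[rotated]) simp
  also have "\<dots> = (n - ?M) choose 2" by (simp add: n_subsets)
  finally have "card (edges G - base_edges m k) \<le> (n - ?M) choose 2" .
  moreover have "card (edges G) \<le> card (base_edges m k) + card (edges G - base_edges m k)"
    using card_Un_le[of "base_edges m k" "edges G - base_edges m k"] G(2) by (simp add: Un_absorb1)
  ultimately have "card (edges G) \<le> ?M + ((n - ?M) choose 2)"
    using card_base_edges[of m k] by linarith
  moreover have "sat_star n (broom 4 m) \<le> card (edges G)"
    unfolding sat_star_def using sat G(1) by (intro cInf_lower) auto
  ultimately show ?thesis by linarith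
qed

section \<open>Tree ends and splitting of sparse graphs\<close>

text \<open>Isolated vertices qualify vacuously. The vertex \<open>u\<close> is the one neighbour of
  \<open>p\<close> that may fail to be a leaf; it need not be a neighbour at all.\<close>

definition tree_end :: "'a set set \<Rightarrow> 'a \<Rightarrow> bool" where
  "tree_end E x \<longleftrightarrow> (\<forall>p. {x, p} \<in> E \<longrightarrow> (\<forall>q. {x, q} \<in> E \<longrightarrow> q = p) \<and>
     (\<exists>u. \<forall>q r. {p, q} \<in> E \<and> q \<noteq> u \<and> {q, r} \<in> E \<longrightarrow> r = p))"

text \<open>
  Deleting all leaves keeps fewer edges than vertices, so some remaining vertex has at most one
  remaining neighbour; any leaf attached to it will do.
\<close>

lemma sparse_has_tree_end:
  assumes V: "finite V" and E: "\<And>e. e \<in> E \<Longrightarrow> e \<subseteq> V \<and> card e = 2" and sparse: "card E < card V"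
  shows "\<exists>x\<in>V. tree_end E x"
proof (rule ccontr)
  assume none: "\<not> ?thesis"
  have finE: "finite E" using V E by (meson Pow_iff finite_Pow_iff finite_subset subsetI)
  have in_V: "x \<in> V" "y \<in> V" "x \<noteq> y" if "{x, y} \<in> E" for x y
    using E[OF that] by auto
  define L where "L = {x \<in> V. \<exists>!p. {x, p} \<in> E}"
  define E1 where "E1 = {e \<in> E. e \<inter> L = {}}"
  have leaf: "q = p" if "x \<in> L" "{x, p} \<in> E" "{x, q} \<in> E" for x p q
    using that by (auto simp: L_def)
  \<comment> \<open>Two adjacent leaves form an isolated edge, whose ends are tree ends.\<close>
  have no_leaf_edge: "p \<notin> L" if xp: "x \<in> L" "{x, p} \<in> E" for x p
  proof
    assume p: "p \<in> L"
    have px: "{p, x} \<in> E" using xp(2) by (simp add: insert_commute)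
    have "tree_end E x"
      unfolding tree_end_def using leaf[OF xp] leaf[OF p px] leaf[OF xp(1)] xp p by metis
    then show False using none xp(2) in_V(1) by blast
  qed
  \<comment> \<open>Each leaf has its own edge, and no edge contains two leaves; so deleting the
    leaves removes at least as many edges as vertices.\<close>
  have "card L \<le> card (E - E1)"
  proof (rule card_inj_on_le)
    let ?f = "\<lambda>x. {x, THE p. {x, p} \<in> E}"
    have f: "?f x \<in> E" if "x \<in> L" for x
      using that theI'[of "\<lambda>p. {x, p} \<in> E"] by (simp add: L_def)
    show "inj_on ?f L"
    proof (rule inj_onI, rule ccontr)
      fix x y assume xy: "x \<in> L" "y \<in> L" "?f x = ?f y" "x \<noteq> y"
      then have "(THE p. {x, p} \<in> E) = y" by (auto simp: doubleton_eq_iff)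
      then show False using f[OF xy(1)] no_leaf_edge[OF xy(1)] xy(2) by simp
    qed
    show "?f ` L \<subseteq> E - E1" using f by (auto simp: E1_def)
    show "finite (E - E1)" using finE by simp
  qed
  moreover have E1: "E1 \<subseteq> E" "finite E1" using finE by (auto simp: E1_def)
  moreover have L: "L \<subseteq> V" "finite L" using V by (auto simp: L_def)
  ultimately have less: "card E1 < card (V - L)"
    using sparse card_mono[OF finE E1(1)] card_mono[OF V L(1)]
    by (simp add: card_Diff_subset)
  \<comment> \<open>Otherwise \<open>v\<close> has at most one neighbour outside \<open>L\<close>.
    Being neither isolated nor a leaf, it has at least two neighbours, so one of them is a leaf
    \<open>y\<close>, and \<open>y\<close> is a tree end.\<close>
  have "2 \<le> card {e \<in> E1. v \<in> e}" if v: "v \<in> V - L" for v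
  proof (rule ccontr)
    assume "\<not> ?thesis"
    then have "card {e \<in> E1. v \<in> e} \<le> Suc 0" by simp
    then have one: "e = f" if "e \<in> E1" "f \<in> E1" "v \<in> e" "v \<in> f" for e f
      using that E1(2) by (auto simp: card_le_Suc0_iff_eq)
    have inE1: "{v, q} \<in> E1" if "{v, q} \<in> E" "q \<notin> L" for q
      using that v by (auto simp: E1_def)
    have "\<exists>p. {v, p} \<in> E" using none v by (auto simp: tree_end_def)
    then obtain p p' where pp: "{v, p} \<in> E" "{v, p'} \<in> E" "p \<noteq> p'"
      using v by (auto simp: L_def)
    have "\<exists>y\<in>L. {v, y} \<in> E"
    proof (rule ccontr)
      assume "\<not> ?thesis"
      then have "{v, p} = {v, p'}" using pp one inE1 by blast
      then show False using pp(3) by (auto simp: doubleton_eq_iff)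
    qed
    then obtain y where y: "y \<in> L" "{v, y} \<in> E" by blast
    have yv: "{y, v} \<in> E" using y(2) by (simp add: insert_commute)
    have "\<exists>u. \<forall>q. {v, q} \<in> E \<and> q \<noteq> u \<longrightarrow> q \<in> L"
    proof (rule ccontr)
      assume *: "\<not> ?thesis"
      then obtain q where q: "{v, q} \<in> E" "q \<notin> L" by blast
      from * obtain q' where q': "{v, q'} \<in> E" "q' \<noteq> q" "q' \<notin> L" by blast
      have "{v, q} = {v, q'}" using one inE1 q q' by blast
      then show False using q'(2) by (auto simp: doubleton_eq_iff)
    qed
    then obtain u where u: "\<And>q. {v, q} \<in> E \<Longrightarrow> q \<noteq> u \<Longrightarrow> q \<in> L" by blast
    have "tree_end E y"
      unfolding tree_end_def
    proof (intro allI impI conjI)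
      fix p assume p: "{y, p} \<in> E"
      then have pv: "p = v" using leaf[OF y(1) yv] by blast
      show "q = p" if "{y, q} \<in> E" for q using leaf[OF y(1) p that] .
      have "r = p" if "{p, q} \<in> E" "q \<noteq> u" "{q, r} \<in> E" for q r
        using leaf[OF u, of q v r] that unfolding pv by (simp add: insert_commute)
      then show "\<exists>u. \<forall>q r. {p, q} \<in> E \<and> q \<noteq> u \<and> {q, r} \<in> E \<longrightarrow> r = p" by blast
    qed
    then show False using none y(1) L(1) by blast
  qed
  \<comment> \<open>Counting incidences in two ways gives at least as many remaining edges as
    vertices.\<close>
  then have "(\<Sum>v\<in>V - L. 2) \<le> (\<Sum>v\<in>V - L. card {e \<in> E1. v \<in> e})"
    by (rule sum_mono)
  also have "\<dots> = (\<Sum>e\<in>E1. card {v \<in> V - L. v \<in> e})"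
    using V E1(2) by (intro sum_multicount_gen) auto
  also have "\<dots> \<le> (\<Sum>e\<in>E1. 2)"
  proof (rule sum_mono)
    fix e assume "e \<in> E1"
    then have "card e = 2" using E E1(1) by blast
    then show "card {v \<in> V - L. v \<in> e} \<le> 2"
      using card_mono[of e "{v \<in> V - L. v \<in> e}"] by (auto simp: card_ge_0_finite)
  qed
  finally show False using less by simp
qed

text \<open>
  A minimal closed set with fewer edges than vertices is connected, so it has a spanning tree and
  the remaining edges are too few for the remaining vertices.
\<close>

lemma sparse_split:
  assumes V: "finite V" and E: "\<And>e. e \<in> E \<Longrightarrow> e \<subseteq> V \<and> card e = 2" and sparse: "card E + 1 < card V"
  obtains C where "C \<subseteq> V" "\<And>e. e \<in> E \<Longrightarrow> e \<subseteq> C \<or> e \<subseteq> V - C"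
    "card {e \<in> E. e \<subseteq> C} < card C" "card {e \<in> E. e \<subseteq> V - C} < card (V - C)"
proof -
  have finE: "finite E" using V E by (meson Pow_iff finite_Pow_iff finite_subset subsetI)
  have split: "card {e \<in> E. e \<subseteq> D} = card {e \<in> E. e \<subseteq> S} + card {e \<in> E. e \<subseteq> D - S}"
    if "S \<subseteq> D" "\<And>e. e \<in> E \<Longrightarrow> e \<subseteq> D \<Longrightarrow> e \<subseteq> S \<or> e \<subseteq> D - S" for D S
  proof -
    have "{e \<in> E. e \<subseteq> D} = {e \<in> E. e \<subseteq> S} \<union> {e \<in> E. e \<subseteq> D - S}" using that by blast
    moreover have "e \<noteq> {}" if "e \<in> E" for e using E[OF that] by auto
    then have "{e \<in> E. e \<subseteq> S} \<inter> {e \<in> E. e \<subseteq> D - S} = {}" by blast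
    ultimately show ?thesis using finE by (simp add: card_Un_disjoint)
  qed
  define P where "P C \<longleftrightarrow> C \<subseteq> V \<and> (\<forall>e\<in>E. e \<subseteq> C \<or> e \<subseteq> V - C) \<and> card {e \<in> E. e \<subseteq> C} < card C" for C
  have PI: "P D" if "D \<subseteq> V" "\<forall>e\<in>E. e \<subseteq> D \<or> e \<subseteq> V - D" "card {e \<in> E. e \<subseteq> D} < card D" for D
    unfolding P_def using that by (intro conjI)
  have "{e \<in> E. e \<subseteq> V} = E" using E by blast
  then have "P V" using E sparse by (auto simp: P_def)
  then obtain C where C: "P C" and min: "\<And>D. P D \<Longrightarrow> card C \<le> card D"
    using ex_has_least_nat[of P V card] by blast
  have finC: "finite C" using C V by (auto simp: P_def intro: finite_subset)
  \<comment> \<open>A tree is grown vertex by vertex. If no edge inside \<open>C\<close> left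
    \<open>S\<close>, then \<open>S\<close> or \<open>C - S\<close> would be a smaller closed set
    with fewer edges than vertices, against the choice of \<open>C\<close>.\<close>
  have grow: "\<exists>S\<subseteq>C. card S = k \<and> k \<le> card {e \<in> E. e \<subseteq> S} + 1" if "1 \<le> k" "k \<le> card C" for k
    using that
  proof (induction k rule: dec_induct)
    case base
    then obtain x where "x \<in> C" by (cases "C = {}") auto
    then show ?case by (intro exI[of _ "{x}"]) auto
  next
    case (step k)
    then obtain S where S: "S \<subseteq> C" "card S = k" "k \<le> card {e \<in> E. e \<subseteq> S} + 1" by auto
    have "\<exists>e\<in>E. e \<subseteq> C \<and> \<not> e \<subseteq> S \<and> \<not> e \<subseteq> C - S"
    proof (rule ccontr)
      assume "\<not> ?thesis"
      then have closed: "e \<subseteq> S \<or> e \<subseteq> C - S" if "e \<in> E" "e \<subseteq> C" for e using that by blast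
      have "card S + card (C - S) = card C"
        using S(1) finC by (metis card_Diff_subset card_mono finite_subset le_add_diff_inverse)
      then have "card {e \<in> E. e \<subseteq> S} < card S \<or> card {e \<in> E. e \<subseteq> C - S} < card (C - S)"
        using split[OF S(1) closed] C by (auto simp: P_def)
      moreover have "\<forall>e\<in>E. e \<subseteq> S \<or> e \<subseteq> V - S" "\<forall>e\<in>E. e \<subseteq> C - S \<or> e \<subseteq> V - (C - S)"
      proof -
        have "e \<subseteq> S \<or> e \<subseteq> C - S \<or> e \<subseteq> V - C" "C \<subseteq> V" if "e \<in> E" for e
          using C closed[of e] that by (auto simp: P_def)
        then show "\<forall>e\<in>E. e \<subseteq> S \<or> e \<subseteq> V - S" "\<forall>e\<in>E. e \<subseteq> C - S \<or> e \<subseteq> V - (C - S)"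
          using S(1) by fast+
      qed
      moreover have "S \<subseteq> V" "C - S \<subseteq> V" using C S(1) by (auto simp: P_def)
      ultimately have "P S \<or> P (C - S)" using PI[of S] PI[of "C - S"] by argo
      then show False
        using min[of S] min[of "C - S"] \<open>card S + card (C - S) = card C\<close> step S(2) by auto
    qed
    then obtain e where e: "e \<in> E" "e \<subseteq> C" "\<not> e \<subseteq> S" "\<not> e \<subseteq> C - S" by blast
    then obtain s t where st: "s \<in> e" "t \<in> e" "s \<in> S" "t \<in> C" "t \<notin> S" by blast
    have "card e = 2" using E e(1) by blast
    then have e': "e = {s, t}" using st by (auto simp: card_2_iff)
    have finS: "finite S" using S(1) finC finite_subset by blast
    have "insert e {f \<in> E. f \<subseteq> S} \<subseteq> {f \<in> E. f \<subseteq> insert t S}"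
      using e e' st by auto
    then have "card (insert e {f \<in> E. f \<subseteq> S}) \<le> card {f \<in> E. f \<subseteq> insert t S}"
      using finE by (intro card_mono) auto
    then have "Suc k \<le> card {f \<in> E. f \<subseteq> insert t S} + 1"
      using S(3) e(3) finE by simp
    then show ?case
      using S st finS by (intro exI[of _ "insert t S"]) auto
  qed
  have "card C \<le> card {e \<in> E. e \<subseteq> C} + 1"
  proof -
    have "1 \<le> card C" using C by (simp add: P_def)
    then obtain S where "S \<subseteq> C" "card S = card C" "card C \<le> card {e \<in> E. e \<subseteq> S} + 1"
      using grow[of "card C"] by auto
    moreover from this have "S = C" using finC by (simp add: card_subset_eq)
    ultimately show ?thesis by simp
  qed
  moreover have "card {e \<in> E. e \<subseteq> C} + card {e \<in> E. e \<subseteq> V - C} = card E"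
    using split[of C V] C \<open>{e \<in> E. e \<subseteq> V} = E\<close> by (auto simp: P_def)
  moreover have "card C + card (V - C) = card V"
    using C V finC by (simp add: P_def card_Diff_subset card_mono)
  ultimately have "card {e \<in> E. e \<subseteq> V - C} < card (V - C)"
    using sparse by linarith
  then show ?thesis using that[of C] C by (auto simp: P_def)
qed

section \<open>Recolouring, the joining edge and the lower bound\<close>

text \<open>The second edge is constrained only if the path goes on to a third: a path on five
  vertices that begins with the joining edge has three further edges.\<close>

definition end_colours :: "'a set set \<Rightarrow> ('a set \<Rightarrow> nat) \<Rightarrow> 'a \<Rightarrow> nat \<Rightarrow> nat \<Rightarrow> bool" where
  "end_colours E c x a b \<longleftrightarrow> (\<forall>p. {x, p} \<in> E \<longrightarrow> c {x, p} = a) \<and>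
     (\<forall>p q r. {x, p} \<in> E \<and> {p, q} \<in> E \<and> {q, r} \<in> E \<and> q \<noteq> x \<and> r \<noteq> p \<longrightarrow> c {p, q} = b)"

lemma tree_end_colours:
  assumes c: "proper_colouring G c" and x: "tree_end (edges G) x"
  shows "\<exists>a b. a \<noteq> b \<and> end_colours (edges G) c x a b"
proof (cases "\<exists>p. {x, p} \<in> edges G")
  case False
  then have "end_colours (edges G) c x 0 1" by (simp add: end_colours_def)
  then show ?thesis by (metis zero_neq_one)
next
  case True
  then obtain p where p: "{x, p} \<in> edges G" by blast
  then obtain u where uniq: "\<And>q. {x, q} \<in> edges G \<Longrightarrow> q = p"
    and u: "\<And>q r. {p, q} \<in> edges G \<Longrightarrow> q \<noteq> u \<Longrightarrow> {q, r} \<in> edges G \<Longrightarrow> r = p"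
    using x unfolding tree_end_def by metis
  \<comment> \<open>A path from \<open>x\<close> of three edges can only pass through
    \<open>u\<close>. If there is no such path, any colour other than \<open>c {x, p}\<close> will
    do.\<close>
  define b where "b = (if {p, u} \<in> edges G \<and> u \<noteq> x then c {p, u} else c {x, p} + 1)"
  have "c {x, p} \<noteq> b"
    using proper_colouringD[OF c, of p x u] p by (auto simp: b_def insert_commute)
  moreover have "end_colours (edges G) c x (c {x, p}) b"
    unfolding end_colours_def b_def using uniq u by metis
  ultimately show ?thesis by blast
qed

text \<open>Every edge of the broom lies on some path \<open>p0 p1 p2 p3 q\<close> with
  \<open>q\<close> in \<open>Q\<close>. If \<open>x y\<close> is an end edge of this path, the
  colours from there start \<open>b, a, b\<close>; if it is an inner edge, its two neighbouring
  edges both have colour \<open>a\<close>.\<close>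

lemma no_rainbow_broom_through_joining_edge:
  assumes m: "m \<ge> 1"
    and x: "end_colours E c x a b" and y: "end_colours E c y a b"
    and xy: "c {x, y} = b" and G: "edges G = insert {x, y} E"
    and R: "rainbow_broom G c m p0 p1 p2 p3 Q"
  shows "broom_edges p0 p1 p2 p3 Q \<subseteq> E"
proof (rule ccontr)
  assume not: "\<not> ?thesis"
  have d: "distinct [p0, p1, p2, p3]" "{p0, p1, p2, p3} \<inter> Q = {}" "card Q = m"
    and sub: "broom_edges p0 p1 p2 p3 Q \<subseteq> insert {x, y} E"
    and inj: "inj_on c (broom_edges p0 p1 p2 p3 Q)"
    using R G by (auto simp: rainbow_broom_def)
  have end_edge: "c {r0, r1} = c {r2, r3}"
    if "{r0, r1} = {x, y}" "distinct [r0, r1, r2, r3, r4]"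
      "{r1, r2} \<in> insert {x, y} E" "{r2, r3} \<in> insert {x, y} E" "{r3, r4} \<in> insert {x, y} E"
    for r0 r1 r2 r3 r4
  proof -
    have "{r1, r2} \<in> E" "{r2, r3} \<in> E" "{r3, r4} \<in> E" "r1 = x \<or> r1 = y"
      using that by (auto simp: doubleton_eq_iff)
    moreover have "r3 \<noteq> r1" "r4 \<noteq> r2" using that(2) by auto
    ultimately have "c {r2, r3} = b" using x y unfolding end_colours_def by metis
    then show ?thesis using xy that(1) by simp
  qed
  have mid_edge: "c {r0, r1} = c {r2, r3}"
    if "{r1, r2} = {x, y}" "distinct [r0, r1, r2, r3]"
      "{r0, r1} \<in> insert {x, y} E" "{r2, r3} \<in> insert {x, y} E" for r0 r1 r2 r3
  proof -
    have "{r1, r0} \<in> E" "{r2, r3} \<in> E" "r1 = x \<and> r2 = y \<or> r1 = y \<and> r2 = x"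
      using that by (auto simp: doubleton_eq_iff insert_commute)
    then have "c {r1, r0} = a" "c {r2, r3} = a" using x y unfolding end_colours_def by metis+
    then show ?thesis by (simp add: insert_commute)
  qed
  obtain q0 where q0: "q0 \<in> Q" using d(3) m by fastforce
  have "{x, y} \<in> broom_edges p0 p1 p2 p3 Q" using not sub by blast
  then obtain q where q: "q \<in> Q"
    "{x, y} \<in> {{p0, p1}, {p1, p2}, {p2, p3}, {p3, q}}"
    unfolding broom_edges_def using q0 by blast
  have dq: "distinct [p0, p1, p2, p3, q]" using d q by auto
  have e: "{p0, p1} \<in> broom_edges p0 p1 p2 p3 Q" "{p1, p2} \<in> broom_edges p0 p1 p2 p3 Q"
    "{p2, p3} \<in> broom_edges p0 p1 p2 p3 Q" "{p3, q} \<in> broom_edges p0 p1 p2 p3 Q"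
    using q by (auto simp: broom_edges_def)
  note E = e[THEN subsetD[OF sub]]
  have ne: "c {p0, p1} \<noteq> c {p2, p3}" "c {p1, p2} \<noteq> c {p3, q}"
    using inj_on_eq_iff[OF inj e(1,3)] inj_on_eq_iff[OF inj e(2,4)] dq
    by (auto simp: doubleton_eq_iff)
  have "{x, y} = {p0, p1} \<or> {x, y} = {p1, p2} \<or> {x, y} = {p2, p3} \<or> {x, y} = {p3, q}"
    using q(2) by (simp only: insert_iff empty_iff simp_thms)
  then show False
  proof (elim disjE)
    assume "{x, y} = {p0, p1}"
    then show False using end_edge[OF _ dq E(2-4)] ne by simp
  next
    assume "{x, y} = {p1, p2}"
    then show False using mid_edge[of p1 p2 p0 p3] E dq ne by simp
  next
    assume "{x, y} = {p2, p3}"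
    then show False using mid_edge[of p2 p3 p1 q] E dq ne by simp
  next
    assume *: "{x, y} = {p3, q}"
    have s: "{q, p3} = {p3, q}" "{p3, p2} = {p2, p3}" "{p2, p1} = {p1, p2}" "{p1, p0} = {p0, p1}"
      by auto
    have "distinct [q, p3, p2, p1, p0]" using dq by auto
    then show False
      using end_edge[of q p3 p2 p1 p0, unfolded s, OF *[symmetric] _ E(3) E(2) E(1)] ne by simp
  qed
qed

lemma saturated_broom_card_edges:
  assumes m: "m \<ge> 1" and sat: "properly_rainbow_saturated (broom 4 m) G"
  shows "card (verts G) \<le> card (edges G) + 1"
proof (rule ccontr)
  assume "\<not> ?thesis"
  then have sparse: "card (edges G) + 1 < card (verts G)" by simp
  have G: "simple_graph G" using sat by (simp add: properly_rainbow_saturated_def)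
  then have V: "finite (verts G)" and E: "\<And>e. e \<in> edges G \<Longrightarrow> e \<subseteq> verts G \<and> card e = 2"
    by (auto simp: simple_graph_def)
  obtain c where c: "proper_colouring G c" and free: "\<nexists>F. rainbow_copy (broom 4 m) G c F"
    using sat by (auto simp: properly_rainbow_saturated_def)
  from sparse_split[OF V E sparse] obtain C where C: "C \<subseteq> verts G"
    "\<And>e. e \<in> edges G \<Longrightarrow> e \<subseteq> C \<or> e \<subseteq> verts G - C"
    and sC: "card {e \<in> edges G. e \<subseteq> C} < card C"
    and sD: "card {e \<in> edges G. e \<subseteq> verts G - C} < card (verts G - C)" by blast
  \<comment> \<open>No edge leaves \<open>D\<close>, so a tree end of the part inside
    \<open>D\<close> is one of \<open>G\<close>.\<close>
  have lift: "\<exists>x\<in>D. tree_end (edges G) x"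
    if D: "D \<subseteq> verts G" "\<And>e. e \<in> edges G \<Longrightarrow> e \<subseteq> D \<or> e \<subseteq> verts G - D"
      "card {e \<in> edges G. e \<subseteq> D} < card D" for D
  proof -
    have "finite D" using D(1) V finite_subset by blast
    define ED where "ED = {e \<in> edges G. e \<subseteq> D}"
    obtain x where x: "x \<in> D" "tree_end ED x"
      using sparse_has_tree_end[OF \<open>finite D\<close>, of ED] D(3) E by (auto simp: ED_def)
    have eq: "{u, v} \<in> ED \<longleftrightarrow> {u, v} \<in> edges G" if "u \<in> D" for u v
      using D(2)[of "{u, v}"] that by (auto simp: ED_def)
    have stay: "v \<in> D" if "u \<in> D" "{u, v} \<in> edges G" for u v
      using D(2)[of "{u, v}"] that by auto
    have "tree_end (edges G) x"
      unfolding tree_end_def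
    proof (intro allI impI conjI)
      fix p assume p: "{x, p} \<in> edges G"
      have pD: "p \<in> D" using stay x(1) p by blast
      have "{x, p} \<in> ED" using eq[OF x(1)] p by simp
      then have "\<forall>q. {x, q} \<in> ED \<longrightarrow> q = p"
          "\<exists>u. \<forall>q r. {p, q} \<in> ED \<and> q \<noteq> u \<and> {q, r} \<in> ED \<longrightarrow> r = p"
        using x(2) by (auto simp: tree_end_def)
      then obtain u where uniq: "\<forall>q. {x, q} \<in> ED \<longrightarrow> q = p"
        and u: "\<forall>q r. {p, q} \<in> ED \<and> q \<noteq> u \<and> {q, r} \<in> ED \<longrightarrow> r = p" by blast
      show "q = p" if "{x, q} \<in> edges G" for q
        using uniq eq[OF x(1)] that by blast
      have "r = p" if "{p, q} \<in> edges G" "q \<noteq> u" "{q, r} \<in> edges G" for q r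
        using u that eq[OF pD] eq[OF stay[OF pD that(1)]] by blast
      then show "\<exists>u. \<forall>q r. {p, q} \<in> edges G \<and> q \<noteq> u \<and> {q, r} \<in> edges G \<longrightarrow> r = p" by blast
    qed
    then show ?thesis using x(1) by blast
  qed
  obtain x where x: "x \<in> C" "tree_end (edges G) x" using lift[OF C sC] by blast
  obtain y where y: "y \<in> verts G - C" "tree_end (edges G) y"
    using lift[of "verts G - C"] C sD by blast
  obtain a b where ab: "a \<noteq> b" "end_colours (edges G) c x a b"
    using tree_end_colours[OF c x(2)] by blast
  obtain a' b' where ab': "a' \<noteq> b'" "end_colours (edges G) c y a' b'"
    using tree_end_colours[OF c y(2)] by blast
  \<comment> \<open>The shift by \<open>a + b + 1\<close> keeps the other colours clear of
    \<open>a\<close> and \<open>b\<close>, so the renaming is injective.\<close>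
  define \<pi> where "\<pi> z = (if z = a' then a else if z = b' then b else a + b + z + 1)" for z
  have \<pi>: "inj \<pi>" "\<pi> a' = a" "\<pi> b' = b"
    using ab ab' by (auto simp: \<pi>_def inj_on_def)
  define c' where "c' e = (if e = {x, y} then b else if e \<subseteq> C then c e else \<pi> (c e))" for e
  have xy: "{x, y} \<notin> edges G" "x \<noteq> y"
    using C(2)[of "{x, y}"] x y by auto
  have ne: "non_edge G {x, y}"
    using xy x y C(1) by (auto simp: non_edge_def)
  have same: "c' e = c' f \<longleftrightarrow> c e = c f" if "e \<in> edges G" "f \<in> edges G" "e \<subseteq> C \<longleftrightarrow> f \<subseteq> C" for e f
    using that xy inj_eq[OF \<pi>(1)] by (auto simp: c'_def)
  have meet: "e \<subseteq> C \<longleftrightarrow> f \<subseteq> C" if "e \<in> edges G" "f \<in> edges G" "e \<inter> f \<noteq> {}" for e f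
    using C(2)[OF that(1)] C(2)[OF that(2)] that(3) by blast
  have c'C: "c' {u, v} = c {u, v}" if "{u, v} \<in> edges G" "u \<in> C" for u v
    using that C(2)[of "{u, v}"] xy by (auto simp: c'_def)
  have c'D: "c' {u, v} = \<pi> (c {u, v})" if "{u, v} \<in> edges G" "u \<notin> C" for u v
    using that C(2)[of "{u, v}"] xy by (auto simp: c'_def)
  have stay: "u \<in> C \<longleftrightarrow> v \<in> C" if "{u, v} \<in> edges G" for u v
    using C(2)[OF that] by auto
  have x': "end_colours (edges G) c' x a b"
    using ab(2) x(1) c'C stay unfolding end_colours_def by metis
  have y': "end_colours (edges G) c' y a b"
    using ab'(2) y(1) c'D stay \<pi>(2,3) unfolding end_colours_def by (metis DiffD2)
  have c'xy: "c' {x, y} = b" by (simp add: c'_def)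
  \<comment> \<open>As \<open>a\<close> and \<open>b\<close> differ, the joining edge may take
    colour \<open>b\<close>.\<close>
  have at_end: "c' e = a" if e: "e \<in> edges G" "e \<inter> {x, y} \<noteq> {}" for e
  proof -
    have "card e = 2" using E e(1) by blast
    then obtain s t where st: "e = {s, t}" by (auto simp: card_2_iff)
    then have st': "{s, t} \<in> edges G" "{t, s} \<in> edges G" "s \<in> {x, y} \<or> t \<in> {x, y}"
      using e by (auto simp: insert_commute)
    have "{t, s} = {s, t}" by auto
    then show ?thesis
      using x' y' st' unfolding st end_colours_def by (metis insertE singletonD)
  qed
  have "proper_colouring (add_edge G {x, y}) c'"
    unfolding proper_colouring_def
  proof (intro ballI impI)
    fix e f
    assume "e \<in> edges (add_edge G {x, y})" "f \<in> edges (add_edge G {x, y})"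
      and ef: "e \<noteq> f \<and> e \<inter> f \<noteq> {}"
    then have *: "e = {x, y} \<or> e \<in> edges G" "f = {x, y} \<or> f \<in> edges G"
      by (auto simp: add_edge_def)
    show "c' e \<noteq> c' f"
    proof (cases "e \<in> edges G \<and> f \<in> edges G")
      case True
      then have "c e \<noteq> c f" using ef c unfolding proper_colouring_def by blast
      then show ?thesis
        using True same[of e f] meet[of e f] ef by simp
    next
      case False
      then show ?thesis
        using * ef ab(1) c'xy at_end[of e] at_end[of f] by (metis Int_commute)
    qed
  qed
  then obtain p0 p1 p2 p3 Q where R: "rainbow_broom (add_edge G {x, y}) c' m p0 p1 p2 p3 Q"
    using sat ne rainbow_copy_broom_iff[OF simple_graph_add_edge[OF G ne]]
    unfolding properly_rainbow_saturated_def by blast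
  let ?B = "broom_edges p0 p1 p2 p3 Q"
  have B: "?B \<subseteq> edges G"
    using no_rainbow_broom_through_joining_edge[OF m x' y' c'xy _ R] by (simp add: add_edge_def)
  \<comment> \<open>A broom is connected, so it lies on one side of the split. There
    \<open>c'\<close> is an injective renaming of \<open>c\<close>, and the broom is already rainbow
    under \<open>c\<close>.\<close>
  have side: "e \<subseteq> C \<longleftrightarrow> p3 \<in> C" if "e \<in> ?B" for e
  proof -
    have 1: "{p0, p1} \<in> edges G" "{p1, p2} \<in> edges G" "{p2, p3} \<in> edges G"
      "\<And>q. q \<in> Q \<Longrightarrow> {p3, q} \<in> edges G"
      using B by (auto simp: broom_edges_def)
    then show ?thesis
      using that stay[OF 1(1)] stay[OF 1(2)] stay[OF 1(3)] stay[OF 1(4)]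
      by (auto simp: broom_edges_def)
  qed
  have "inj_on c ?B"
  proof (rule inj_onI)
    fix e f assume ef: "e \<in> ?B" "f \<in> ?B" "c e = c f"
    then have "c' e = c' f" using same[of e f] side B by blast
    moreover have "inj_on c' ?B" using R by (simp add: rainbow_broom_def)
    ultimately show "e = f" using ef by (simp add: inj_on_eq_iff)
  qed
  then have "rainbow_broom G c m p0 p1 p2 p3 Q"
    using R B by (simp add: rainbow_broom_def)
  then show False using free rainbow_copy_broom_iff[OF G] by blast
qed

theorem theorem1p2:
  fixes m n :: nat
  assumes "m \<ge> 1" and "n \<ge> 3 * (m + 2)"
  shows "n - 1 \<le> sat_star n (broom 4 m) \<and>
         sat_star n (broom 4 m) \<le>
           3 * (m + 2) * (n div (3 * (m + 2))) +
           ((n - 3 * (m + 2) * (n div (3 * (m + 2)))) choose 2)"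
proof
  have "simple_graph (broom 4 m)" "edges (broom 4 m) \<noteq> {}"
    by (simp_all add: simple_graph_broom edges_broom_4 broom_edges_def)
  \<comment> \<open>The broom has an edge, so the infimum is attained and the bound for one
    saturated graph applies.\<close>
  then obtain G :: "nat ugraph" where "card (verts G) = n"
      "properly_rainbow_saturated (broom 4 m) G" "card (edges G) = sat_star n (broom 4 m)"
    using sat_star_attained by blast
  then show "n - 1 \<le> sat_star n (broom 4 m)"
    using saturated_broom_card_edges[OF assms(1), of G] by simp
  show "sat_star n (broom 4 m) \<le> 3 * (m + 2) * (n div (3 * (m + 2))) +
      ((n - 3 * (m + 2) * (n div (3 * (m + 2)))) choose 2)"
    \<comment> \<open>The number \<open>k\<close> of copies is the largest that fits into
      \<open>n\<close> vertices.\<close>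
    by (rule sat_star_broom_le[OF assms(1)]) (rule times_div_less_eq_dividend)
qed

end
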